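(* Let $\lambda$ be a nonzero real number. For all integers $n,k\ge0$ with $n\ge k$, \[ S_{J,\lambda}^{(2)}(n,k)=\frac{1}{k!}\sum_{l=0}^{k}\binom{k}{l}(-1)^{k-l}B_{n,\lambda}(l). \]
   Context: For a nonzero real $\lambda$, set $(x)_{0,\lambda}=1$ and $(x)_{n,\lambda}=x(x-\lambda)\cdots(x-(n-1)\lambda)$ for $n\ge1$. Let $e_\lambda^x(t)=\sum_{n\ge0}(x)_{n,\lambda}\frac{t^n}{n!}=(1+\lambda t)^{x/\lambda}$ and $e_\lambda(t)=e_\lambda^1(t)$. The degenerate Bell polynomials are defined by $e_\lambda^x(e_\lambda(t)-1)=\sum_{n\ge0}B_{n,\lambda}(x)\frac{t^n}{n!}$. The Jindalrae-Stirling numbers of the second kind are defined by $\frac{1}{k!}\big(e_\lambda(e_\lambda(t)-1)-1\big)^k=\sum_{n\ge k}S_{J,\lambda}^{(2)}(n,k)\frac{t^n}{n!}$ for $k\ge0$. *)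

theory Defs
  imports "HOL-Computational_Algebra.Computational_Algebra"
begin

text \<open>All generating functions are formal power series in \<open>t\<close> over the reals.\<close>

definition deg_ffact :: "real \<Rightarrow> real \<Rightarrow> nat \<Rightarrow> real" where
  "deg_ffact lam x n = (\<Prod>i<n. x - real i * lam)"

definition deg_exp :: "real \<Rightarrow> real \<Rightarrow> real fps" where
  "deg_exp lam x = Abs_fps (\<lambda>n. deg_ffact lam x n / fact n)"

text \<open>The closed form \<open>(1 + lam t)^(x/lam)\<close> of the degenerate exponential.\<close>

lemma deg_exp_eq_binomial:
  assumes "lam \<noteq> 0"
  shows "deg_exp lam x = fps_compose (fps_binomial (x / lam)) (fps_const lam * fps_X)"
proof (rule fps_ext)
  fix n
  have "(\<Prod>i<n. x - real i * lam) = lam ^ n * (\<Prod>i<n. x / lam - real i)"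
    using assms by (induction n) (simp_all add: field_simps)
  then show "fps_nth (deg_exp lam x) n =
      fps_nth (fps_compose (fps_binomial (x / lam)) (fps_const lam * fps_X)) n"
    by (simp add: deg_exp_def deg_ffact_def fps_compose_linear gbinomial_prod_rev
        atLeast0LessThan)
qed

text \<open>
  The inner series \<open>deg_exp lam 1 - 1\<close> has zero constant term, so the compositions
  below are the genuine substitutions of power series.
\<close>

lemma deg_exp_minus_1_nth_0: "fps_nth (deg_exp lam x - 1) 0 = 0"
  by (simp add: deg_exp_def deg_ffact_def)

definition deg_bell :: "real \<Rightarrow> nat \<Rightarrow> real \<Rightarrow> real" where
  "deg_bell lam n x =
     fact n * fps_nth (fps_compose (deg_exp lam x) (deg_exp lam 1 - 1)) n"

lemma deg_bell_gf:
  "Abs_fps (\<lambda>n. deg_bell lam n x / fact n) =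
     fps_compose (deg_exp lam x) (deg_exp lam 1 - 1)"
  by (rule fps_ext) (simp add: deg_bell_def)

definition jindalrae_stirling2 :: "real \<Rightarrow> nat \<Rightarrow> nat \<Rightarrow> real" where
  "jindalrae_stirling2 lam n k =
     fact n * fps_nth (fps_const (1 / fact k) *
       (fps_compose (deg_exp lam 1) (deg_exp lam 1 - 1) - 1) ^ k) n"

text \<open>
  The defining generating function sums over \<open>n \<ge> k\<close> only; the coefficients with
  \<open>n < k\<close> vanish.
\<close>

lemma jindalrae_stirling2_eq_0:
  assumes "n < k"
  shows "jindalrae_stirling2 lam n k = 0"
proof -
  have "fps_nth (fps_compose (deg_exp lam 1) (deg_exp lam 1 - 1) - 1) 0 = 0"
    by (simp add: deg_exp_def deg_ffact_def)
  then show ?thesis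
    using assms by (simp add: jindalrae_stirling2_def startsby_zero_power_prefix)
qed

lemma jindalrae_stirling2_gf:
  "Abs_fps (\<lambda>n. if n \<ge> k then jindalrae_stirling2 lam n k / fact n else 0) =
     fps_const (1 / fact k) *
       (fps_compose (deg_exp lam 1) (deg_exp lam 1 - 1) - 1) ^ k"
proof -
  have "(if n \<ge> k then jindalrae_stirling2 lam n k / fact n else 0) =
      jindalrae_stirling2 lam n k / fact n" for n
    using jindalrae_stirling2_eq_0[of n k lam] by auto
  then show ?thesis
    by (intro fps_ext) (simp add: jindalrae_stirling2_def)
qed

end

theory Submission
  imports Defs
begin

text \<open>
  The degenerate exponential is multiplicative in its exponent, so substituting
  \<open>e\<^sub>\<lambda>(t) - 1\<close> into \<open>e\<^sub>\<lambda>\<^sup>l\<close> gives the \<open>l\<close>-th power of \<open>G = e\<^sub>\<lambda>(e\<^sub>\<lambda>(t) - 1)\<close>.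
  The number \<open>B\<^sub>n(l)\<close> is therefore \<open>n!\<close> times the \<open>n\<close>-th coefficient of \<open>G\<^sup>l\<close>, and expanding
  \<open>(G - 1)\<^sup>k\<close> by the binomial theorem expresses the Stirling numbers through these.
\<close>

unbundle fps_syntax

lemma fps_nth_diff_one_power:
  fixes f :: "'a::comm_ring_1 fps"
  shows "(f - 1) ^ k $ n = (\<Sum>l = 0..k. of_nat (k choose l) * (-1) ^ (k - l) * f ^ l $ n)"
proof -
  have const_coeff: "of_nat (k choose l) * f ^ l * (-1) ^ (k - l) =
      fps_const (of_nat (k choose l) * (-1) ^ (k - l)) * f ^ l" for l
    by (simp add: mult_ac flip: fps_of_nat fps_const_power fps_const_neg fps_const_1_eq_1
        fps_const_mult)
  have "(f - 1) ^ k = (\<Sum>l\<le>k. of_nat (k choose l) * f ^ l * (-1) ^ (k - l))"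
    using binomial_ring[of f "-1" k] by simp
  then show ?thesis
    by (simp add: const_coeff fps_sum_nth atLeast0AtMost)
qed

lemma deg_exp_lam_0: "deg_exp 0 x = fps_exp x"
  by (rule fps_ext) (simp add: deg_exp_def deg_ffact_def)

lemma deg_exp_add: "deg_exp lam (x + y) = deg_exp lam x * deg_exp lam y"
proof (cases "lam = 0")
  case True
  then show ?thesis
    by (simp add: deg_exp_lam_0 fps_exp_add_mult)
next
  case False
  then show ?thesis
    by (simp add: deg_exp_eq_binomial add_divide_distrib fps_binomial_add_mult
        fps_compose_mult_distrib)
qed

lemma deg_exp_0: "deg_exp lam 0 = 1"
  by (rule fps_ext) (auto simp: deg_exp_def deg_ffact_def)

lemma deg_exp_of_nat_mult: "deg_exp lam (real l * x) = deg_exp lam x ^ l"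
  by (induction l) (simp_all add: deg_exp_0 deg_exp_add distrib_right)

definition deg_bell_fps :: "real \<Rightarrow> real \<Rightarrow> real fps" where
  "deg_bell_fps lam x = deg_exp lam x oo (deg_exp lam 1 - 1)"

lemma deg_bell_eq_nth: "deg_bell lam n x = fact n * deg_bell_fps lam x $ n"
  by (simp add: deg_bell_def deg_bell_fps_def)

lemma jindalrae_stirling2_eq_nth:
  "jindalrae_stirling2 lam n k = fact n / fact k * (deg_bell_fps lam 1 - 1) ^ k $ n"
  by (simp add: jindalrae_stirling2_def deg_bell_fps_def)

lemma deg_bell_fps_of_nat_mult: "deg_bell_fps lam (real l * x) = deg_bell_fps lam x ^ l"
  by (simp add: deg_bell_fps_def deg_exp_of_nat_mult
      fps_compose_power[OF deg_exp_minus_1_nth_0])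

theorem theorem6:
  fixes lam :: real and n k :: nat
  assumes "lam \<noteq> 0" and "n \<ge> k"
  shows "jindalrae_stirling2 lam n k =
    1 / fact k * (\<Sum>l = 0..k. real (k choose l) * (-1) ^ (k - l) * deg_bell lam n (real l))"
proof -
  let ?G = "deg_bell_fps lam 1"
  have bell: "deg_bell lam n (real l) = fact n * ?G ^ l $ n" for l
    using deg_bell_fps_of_nat_mult[of lam l 1] by (simp add: deg_bell_eq_nth)
  have "jindalrae_stirling2 lam n k = fact n / fact k * (?G - 1) ^ k $ n"
    by (rule jindalrae_stirling2_eq_nth)
  also have "\<dots> = fact n / fact k *
      (\<Sum>l = 0..k. real (k choose l) * (-1) ^ (k - l) * ?G ^ l $ n)"
    by (simp add: fps_nth_diff_one_power)
  also have "\<dots> = 1 / fact k *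
      (\<Sum>l = 0..k. real (k choose l) * (-1) ^ (k - l) * deg_bell lam n (real l))"
    by (simp add: bell sum_distrib_left mult_ac)
  finally show ?thesis .
qed

unbundle no fps_syntax

end
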